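(* Let $A\in\mathbb{C}^{n\times n}$ and $b_0,b_1,\dots,b_s\in\mathbb{C}^n$ with $b_s\neq 0$. Let $K$, $c$ be the KIOPS augmented matrix and starting vector and $W$, $b$ the block matrix and vector defined in the context, and let $\Pi_{\rm K}=[I_n,0]\in\mathbb{C}^{n\times(n+s)}$. Then for every $m\ge1$, $$\inf_{p\in\mathcal P_{m-1}}\bigl\|\Pi_{\rm K}\bigl(\mathrm{e}^{K}-p(K)\bigr)c\bigr\|_2\;\le\; C_{\rm cr}\,\|b\|_2\,E_{m-1}\bigl(\mathrm{e}^z,\mathcal F(W)\bigr).$$
   Context: For a square complex matrix $M$, $\mathcal F(M)=\{z^*Mz/(z^*z): z\ne0\}$ is the field of values. $\mathcal P_{m-1}$ is the space of complex polynomials of degree at most $m-1$, and for compact $\Omega\subset\mathbb{C}$, $$E_{m-1}(f,\Omega)=\min_{p\in\mathcal P_{m-1}}\max_{\zeta\in\Omega}|f(\zeta)-p(\zeta)|.$$ $C_{\rm cr}\le 1+\sqrt2$ denotes the universal (matrix-independent) constant of the Crouzeix--Palencia theorem: $\|f(M)\|_2\le C_{\rm cr}\max_{\zeta\in\mathcal F(M)}|f(\zeta)|$ for every square complex matrix $M$ (of any size) and every $f$ analytic on a neighborhood of $\mathcal F(M)$. Let $n,s\ge1$. $J_s(0)$ is the $s\times s$ Jordan block with eigenvalue zero (ones on the first superdiagonal, zeros elsewhere), and $e_s$ is the last column of the $s\times s$ identity matrix. The KIOPS matrix and starting vector are $$K=\begin{bmatrix}A&B\\ 0&J_s(0)\end{bmatrix}\in\mathbb{C}^{(n+s)\times(n+s)},\quad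 B=[b_s,b_{s-1},\dots,b_1]\in\mathbb{C}^{n\times s},\quad c=\begin{bmatrix}b_0\\ {e_s}\end{bmatrix}.$$ The larger block matrix is $$W=\begin{bmatrix}A&E\\ 0&J\end{bmatrix}\in\mathbb{C}^{(s+1)n\times(s+1)n},\quad E=[I_n,0,\dots,0]\in\mathbb{C}^{n\times ns},\quad J=J_s(0)\otimes I_n,$$ and $b=[b_0^*,b_1^*,\dots,b_s^*]^*\in\mathbb{C}^{(s+1)n}$. *)

theory Defs
  imports
    "HOL-Complex_Analysis.Complex_Analysis"
    "Jordan_Normal_Form.Jordan_Normal_Form"
begin

unbundle no vec_syntax

text \<open>Rows, columns and vector entries are indexed from 0. The matrix type does not carry the
  dimension, so a statement about \<^typ>\<open>complex mat\<close> can quantify over square matrices of every size.\<close>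

definition vec_norm2 :: "complex vec \<Rightarrow> real" where
  "vec_norm2 v = L2_set (\<lambda>i. cmod (v $ i)) {..<dim_vec v}"

definition mat_norm2 :: "complex mat \<Rightarrow> real" where
  "mat_norm2 M = (SUP v\<in>{v \<in> carrier_vec (dim_col M). vec_norm2 v = 1}. vec_norm2 (M *\<^sub>v v))"

text \<open>Since \<^term>\<open>v \<bullet>c w\<close> conjugates its second argument, \<^term>\<open>(M *\<^sub>v z) \<bullet>c z\<close> is $z^* M z$.\<close>

definition field_of_values :: "complex mat \<Rightarrow> complex set" where
  "field_of_values M =
     {((M *\<^sub>v z) \<bullet>c z) / (z \<bullet>c z) | z. z \<in> carrier_vec (dim_row M) \<and> z \<noteq> 0\<^sub>v (dim_row M)}"

definition mat_poly :: "complex poly \<Rightarrow> complex mat \<Rightarrow> complex mat" where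
  "mat_poly p M = mat (dim_row M) (dim_row M)
     (\<lambda>(i, j). \<Sum>k\<le>degree p. coeff p k * (M ^\<^sub>m k) $$ (i, j))"

definition mat_exp :: "complex mat \<Rightarrow> complex mat" where
  "mat_exp M = mat (dim_row M) (dim_row M) (\<lambda>(i, j). \<Sum>k. (M ^\<^sub>m k) $$ (i, j) / fact k)"

text \<open>The matrix function $f(M)$ is $p(M)$ for any polynomial $p$ that agrees with $f$ at each
  eigenvalue $\mu$ of $M$, together with all derivatives of order below the algebraic
  multiplicity of $\mu$ (Hermite interpolation). Such $p$ exists, and two of them differ by a
  multiple of the characteristic polynomial, so by Cayley--Hamilton the choice does not matter.
  If $\mu$ is not an eigenvalue, its order is 0 and nothing is required there.\<close>

definition hermite_interpolates :: "complex poly \<Rightarrow> (complex \<Rightarrow> complex) \<Rightarrow> complex mat \<Rightarrow> bool" where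
  "hermite_interpolates p f M \<longleftrightarrow>
     (\<forall>\<mu>. \<forall>j < Polynomial.order \<mu> (char_poly M). poly ((pderiv ^^ j) p) \<mu> = (deriv ^^ j) f \<mu>)"

definition mat_fun :: "(complex \<Rightarrow> complex) \<Rightarrow> complex mat \<Rightarrow> complex mat" where
  "mat_fun f M = mat_poly (SOME p. hermite_interpolates p f M) M"

definition poly_space :: "nat \<Rightarrow> complex poly set" where
  "poly_space d = {p. degree p \<le> d}"

text \<open>In the next two definitions the functions whose suprema are taken are continuous and are used
  only on nonempty compact sets, so each supremum is a maximum. The infimum over polynomials is
  attained as well (best approximation from a finite-dimensional space).\<close>

definition best_approx :: "nat \<Rightarrow> (complex \<Rightarrow> complex) \<Rightarrow> complex set \<Rightarrow> real" where
  "best_approx d f \<Omega> = (INF p\<in>poly_space d. SUP \<zeta>\<in>\<Omega>. cmod (f \<zeta> - poly p \<zeta>))"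

text \<open>The Crouzeix--Palencia theorem says that \<open>1 + sqrt 2\<close> satisfies the following property.\<close>

definition crouzeix_palencia_bound :: "real \<Rightarrow> bool" where
  "crouzeix_palencia_bound C \<longleftrightarrow>
     (\<forall>N M f. N \<ge> 1 \<longrightarrow> M \<in> carrier_mat N N \<longrightarrow> f analytic_on field_of_values M \<longrightarrow>
        mat_norm2 (mat_fun f M) \<le> C * (SUP \<zeta>\<in>field_of_values M. cmod (f \<zeta>)))"

text \<open>The matrix $[I_n, 0]$ with $n$ rows and $N \ge n$ columns.\<close>

definition eye_zero :: "nat \<Rightarrow> nat \<Rightarrow> complex mat" where
  "eye_zero n N = mat n N (\<lambda>(i, j). if i = j then 1 else 0)"

definition kron :: "complex mat \<Rightarrow> complex mat \<Rightarrow> complex mat" where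
  "kron X Y = mat (dim_row X * dim_row Y) (dim_col X * dim_col Y)
     (\<lambda>(i, j). X $$ (i div dim_row Y, j div dim_col Y) * Y $$ (i mod dim_row Y, j mod dim_col Y))"

definition kiops_B :: "nat \<Rightarrow> nat \<Rightarrow> (nat \<Rightarrow> complex vec) \<Rightarrow> complex mat" where
  "kiops_B n s b = mat_of_cols n (map b (rev [1..<Suc s]))"

definition kiops_K :: "nat \<Rightarrow> nat \<Rightarrow> complex mat \<Rightarrow> (nat \<Rightarrow> complex vec) \<Rightarrow> complex mat" where
  "kiops_K n s A b = four_block_mat A (kiops_B n s b) (0\<^sub>m s n) (jordan_block s 0)"

definition kiops_c :: "nat \<Rightarrow> (nat \<Rightarrow> complex vec) \<Rightarrow> complex vec" where
  "kiops_c s b = b 0 @\<^sub>v unit_vec s (s - 1)"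

definition block_W :: "nat \<Rightarrow> nat \<Rightarrow> complex mat \<Rightarrow> complex mat" where
  "block_W n s A =
     four_block_mat A (eye_zero n (n * s)) (0\<^sub>m (n * s) n) (kron (jordan_block s 0) (1\<^sub>m n))"

text \<open>The column vector obtained by stacking \<open>b 0, \<dots>, b s\<close>.\<close>

definition stacked_b :: "nat \<Rightarrow> nat \<Rightarrow> (nat \<Rightarrow> complex vec) \<Rightarrow> complex vec" where
  "stacked_b n s b = vec ((s + 1) * n) (\<lambda>i. b (i div n) $ (i mod n))"

end

(* The vectors K^k c and W^k b have the same first n entries, so the left-hand side does not change
   when K and c are replaced by W and b. The error is then at most the 2-norm of e^W - p(W) times
   that of b, and the Crouzeix-Palencia bound applies to e^z - p(z).

   That bound is stated for matrix functions defined by Hermite interpolation, so for entire f this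
   definition must be matched with the power series. If q interpolates f on the spectrum of M, then
   f - q = chi h with chi the characteristic polynomial and h entire, and Cayley-Hamilton makes the
   power series of chi h vanish at M. *)

theory Submission
  imports Defs
begin

section \<open>Hermite interpolation and entire quotients\<close>

text \<open>In characteristic zero each derivative lowers the order of a root by exactly one. It
  stays nonzero, since only constants have derivative zero and a nonzero constant has no
  root.\<close>

lemma order_funpow_pderiv:
  fixes P :: "complex poly"
  assumes "P \<noteq> 0" "j \<le> Polynomial.order \<mu> P"
  shows "(pderiv ^^ j) P \<noteq> 0 \<and> Polynomial.order \<mu> ((pderiv ^^ j) P) = Polynomial.order \<mu> P - j"
  using assms(2)
proof (induction j)
  case 0
  then show ?case using assms by simp
next
  case (Suc j)
  let ?Q = "(pderiv ^^ j) P"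
  from Suc.IH[OF Suc_leD[OF Suc.prems]] have Q: "?Q \<noteq> 0" "Polynomial.order \<mu> ?Q = Polynomial.order \<mu> P - j" by blast+
  with Suc.prems have "Polynomial.order \<mu> ?Q \<noteq> 0" by simp
  then have r: "poly ?Q \<mu> = 0" using order_root by blast
  have "pderiv ?Q \<noteq> 0"
  proof
    assume "pderiv ?Q = 0"
    then obtain c where "?Q = [:c:]" by (metis pderiv_eq_0_iff degree_eq_zeroE)
    with r Q show False by simp
  qed
  moreover have "Polynomial.order \<mu> ?Q = Suc (Polynomial.order \<mu> (pderiv ?Q))"
    by (rule order_pderiv[OF Q(1) r])
  ultimately show ?case using Q by simp
qed

lemma poly_funpow_pderiv_below_order:
  fixes P :: "complex poly"
  assumes "P \<noteq> 0" "j < Polynomial.order \<mu> P"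
  shows "poly ((pderiv ^^ j) P) \<mu> = 0"
  using order_funpow_pderiv[of P j \<mu>] assms order_root by force

lemma poly_funpow_pderiv_order:
  fixes P :: "complex poly"
  assumes "P \<noteq> 0"
  shows "poly ((pderiv ^^ Polynomial.order \<mu> P) P) \<mu> \<noteq> 0"
  using order_funpow_pderiv[of P "Polynomial.order \<mu> P" \<mu>] assms by (simp add: order_root)

lemma prod_linear_factors_nonzero: "(\<Prod>a\<leftarrow>xs. [:- a, 1:] :: complex poly) \<noteq> 0"
  by (auto simp: prod_list_zero_iff)

text \<open>Both inductions over a list of roots rest on this count: prepending \<open>x\<close>
  creates a single new condition, at \<open>x\<close>, on the derivative whose order is the old
  multiplicity.\<close>

lemma order_prod_list_Cons:
  "Polynomial.order \<mu> (\<Prod>a\<leftarrow>x # xs. [:- a, 1:]) =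
     (if \<mu> = x then 1 else 0) + Polynomial.order \<mu> (\<Prod>a\<leftarrow>xs. [:- a, 1:] :: complex poly)"
proof -
  have "[:- x, 1:] * (\<Prod>a\<leftarrow>xs. [:- a, 1:]) \<noteq> 0"
    using prod_linear_factors_nonzero[of "x # xs"] by simp
  moreover have "Polynomial.order \<mu> [:- x, 1:] = (if \<mu> = x then 1 else 0)"
    using order_power_n_n[of x 1] by (auto intro!: order_0I)
  ultimately show ?thesis by (simp add: order_mult del: mult_pCons_left)
qed

text \<open>Newton interpolation: adding a multiple of the product over \<open>xs\<close> keeps
  every earlier condition, since that product vanishes there to the required order, and the scalar
  is free to meet the new condition.\<close>

lemma hermite_interpolant_exists:
  "\<exists>p. \<forall>\<mu>. \<forall>j < Polynomial.order \<mu> (\<Prod>a\<leftarrow>xs. [:- a, 1:] :: complex poly).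
     poly ((pderiv ^^ j) p) \<mu> = v \<mu> j"
proof (induction xs)
  case Nil
  then show ?case by (simp add: order_1_eq_0)
next
  case (Cons x xs)
  let ?P = "\<Prod>a\<leftarrow>xs. [:- a, 1:] :: complex poly"
  have P: "?P \<noteq> 0" by (rule prod_linear_factors_nonzero)
  let ?k = "Polynomial.order x ?P"
  obtain p where p: "poly ((pderiv ^^ j) p) \<mu> = v \<mu> j" if "j < Polynomial.order \<mu> ?P" for \<mu> j
    using Cons.IH by blast
  \<comment> \<open>Solves the condition of order \<open>?k\<close> at \<open>x\<close>; the
    denominator is nonzero because \<open>?P\<close> vanishes at \<open>x\<close> to order exactly
    \<open>?k\<close>.\<close>
  define c where "c = (v x ?k - poly ((pderiv ^^ ?k) p) x) / poly ((pderiv ^^ ?k) ?P) x"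
  show ?case
  proof (intro exI[of _ "p + Polynomial.smult c ?P"] allI impI)
    fix \<mu> j assume j: "j < Polynomial.order \<mu> (\<Prod>a\<leftarrow>x # xs. [:- a, 1:])"
    show "poly ((pderiv ^^ j) (p + Polynomial.smult c ?P)) \<mu> = v \<mu> j"
    proof (cases "j < Polynomial.order \<mu> ?P")
      case True
      then show ?thesis
        by (simp add: higher_pderiv_add higher_pderiv_smult p poly_funpow_pderiv_below_order[OF P])
    next
      case False
      with j have "\<mu> = x" "j = ?k" unfolding order_prod_list_Cons by (auto split: if_splits)
      then show ?thesis
        using poly_funpow_pderiv_order[OF P, of x]
        by (simp add: higher_pderiv_add higher_pderiv_smult c_def)
    qed
  qed
qed

text \<open>Leibniz rule: a linear factor has no derivatives beyond the first, so two terms remain.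
  For \<open>j = 0\<close> the truncated \<open>j - 1\<close> is harmless, as its coefficient is
  zero.\<close>

lemma higher_deriv_linear_mult:
  assumes "h holomorphic_on UNIV"
  shows "(deriv ^^ j) (\<lambda>z. (z - a) * h z) w
           = (w - a) * (deriv ^^ j) h w + of_nat j * (deriv ^^ (j - 1)) h w"
proof (induction j arbitrary: w)
  case 0
  then show ?case by simp
next
  case (Suc j)
  have hol: "(deriv ^^ i) h holomorphic_on UNIV" for i
    using assms by (rule holomorphic_higher_deriv) simp
  have D: "((deriv ^^ i) h has_field_derivative (deriv ^^ Suc i) h w) (at w)" for i
    using holomorphic_derivI[OF hol, of w i] by simp
  have IH: "(deriv ^^ j) (\<lambda>z. (z - a) * h z)
      = (\<lambda>w. (w - a) * (deriv ^^ j) h w + of_nat j * (deriv ^^ (j - 1)) h w)"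
    by (rule ext) (rule Suc.IH)
  have "(deriv ^^ Suc j) (\<lambda>z. (z - a) * h z) w
      = deriv (\<lambda>w. (w - a) * (deriv ^^ j) h w + of_nat j * (deriv ^^ (j - 1)) h w) w"
    by (simp add: IH)

  also have "\<dots> = (w - a) * (deriv ^^ Suc j) h w + of_nat (Suc j) * (deriv ^^ j) h w"
  proof (cases j)
    case 0
    show ?thesis unfolding 0
      by (rule DERIV_imp_deriv) (use D[of 0] in \<open>auto intro!: derivative_eq_intros\<close>)
  next
    case (Suc i)
    show ?thesis unfolding Suc
      by (rule DERIV_imp_deriv)
        (use D[of i] D[of j] in \<open>auto intro!: derivative_eq_intros simp: Suc algebra_simps\<close>)
  qed
  finally show ?case by simp
qed

text \<open>Roots are divided out one at a time. The singularity of the quotient is removable, and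
  the Leibniz rule hands the remaining vanishing conditions down to it.\<close>

lemma entire_factor_out_roots:
  assumes "g holomorphic_on UNIV"
    and "\<And>\<mu> j. j < Polynomial.order \<mu> (\<Prod>a\<leftarrow>xs. [:- a, 1:] :: complex poly) \<Longrightarrow> (deriv ^^ j) g \<mu> = 0"
  shows "\<exists>h. h holomorphic_on UNIV \<and> g = (\<lambda>z. poly (\<Prod>a\<leftarrow>xs. [:- a, 1:]) z * h z)"
  using assms
proof (induction xs arbitrary: g)
  case Nil
  then show ?case by auto
next
  case (Cons x xs)
  let ?P = "\<Prod>a\<leftarrow>xs. [:- a, 1:] :: complex poly"
  \<comment> \<open>As \<open>g x = 0\<close>, the value \<open>deriv g x\<close> is the limit of
    the quotient at \<open>x\<close>.\<close>
  define g1 where "g1 z = (if z = x then deriv g x else g z / (z - x))" for z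
  have "(deriv ^^ 0) g x = 0" by (rule Cons.prems(2)) (subst order_prod_list_Cons, simp)
  then have gx: "g x = 0" by simp
  have g1: "g1 holomorphic_on UNIV"
    by (rule pole_theorem_0[OF Cons.prems(1), of x]) (auto simp: g1_def gx)
  have g: "g = (\<lambda>z. (z - x) * g1 z)" by (auto simp: g1_def gx)
  have "(deriv ^^ j) g1 \<mu> = 0" if "j < Polynomial.order \<mu> ?P" for \<mu> j
    using that
  proof (induction j rule: less_induct)
    case (less j)
    show ?case
    proof (cases "\<mu> = x")
      \<comment> \<open>At \<open>x\<close> the full product has order one larger, so derivative
        \<open>Suc j\<close> of \<open>g\<close> vanishes too; there the Leibniz rule leaves only
        \<open>Suc j\<close> times derivative \<open>j\<close> of \<open>g1\<close>.\<close>
      case True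
      then have "(deriv ^^ Suc j) g \<mu> = 0"
        using less.prems by (intro Cons.prems(2)) (subst order_prod_list_Cons, simp)
      then show ?thesis
        unfolding g higher_deriv_linear_mult[OF g1] using True 
        by (simp del: funpow.simps of_nat_Suc)
    next
      \<comment> \<open>Away from \<open>x\<close> the factor \<open>\<mu> - x\<close> can be
        cancelled once the term with the lower derivative of \<open>g1\<close> is gone, which the
        induction supplies.\<close>
      case False
      then have "(deriv ^^ j) g \<mu> = 0"
        using less.prems by (intro Cons.prems(2)) (subst order_prod_list_Cons, simp)
      moreover have "of_nat j * (deriv ^^ (j - 1)) g1 \<mu> = 0"
        using less.IH[of "j - 1"] less.prems by (cases j) auto
      ultimately show ?thesis
        unfolding g higher_deriv_linear_mult[OF g1] using False by (simp only: add_0_right mult_eq_0_iff) auto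
    qed
  qed
  from Cons.IH[OF g1 this] obtain h where h: "h holomorphic_on UNIV" "g1 = (\<lambda>z. poly ?P z * h z)"
    by blast
  show ?case
    by (rule exI[of _ h]) (use h(1) in \<open>auto simp: g h(2) algebra_simps\<close>)
qed

lemma higher_deriv_poly: "(deriv ^^ j) (poly p) = poly ((pderiv ^^ j) (p :: complex poly))"
proof (induction j)
  case (Suc j)
  then show ?case by (auto intro!: DERIV_imp_deriv poly_DERIV)
qed simp

section \<open>The Cayley--Hamilton theorem\<close>

lemma pow_mat_add:
  assumes "M \<in> carrier_mat n n"
  shows "M ^\<^sub>m (k + l) = M ^\<^sub>m k * M ^\<^sub>m l"
proof (induction l)
  case 0
  then show ?case using assms right_mult_one_mat[of "M ^\<^sub>m k" n n] by simp
next
  case (Suc l)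
  then show ?case using assms by (simp add: assoc_mult_mat[of _ n n _ n _ n])
qed

lemma mult_mat_entry:
  assumes "M \<in> carrier_mat n n" "N \<in> carrier_mat n n" "i < n" "j < n"
  shows "(M * N) $$ (i, j) = (\<Sum>r<n. M $$ (i, r) * N $$ (r, j))"
  using assms by (auto simp: scalar_prod_def lessThan_atLeast0 intro!: sum.cong)

text \<open>Comparing coefficients in \<open>(x I - M) adj (x I - M) = \<chi>(x) I\<close> makes the sum
  \<open>\<Sum> \<chi>\<^sub>k M\<^sup>k\<close> telescope.\<close>

lemma cayley_hamilton_entry:
  fixes M :: "complex mat"
  assumes M: "M \<in> carrier_mat n n" and i: "i < n" and j: "j < n"
  shows "(\<Sum>k\<le>degree (char_poly M). coeff (char_poly M) k * (M ^\<^sub>m k) $$ (i, j)) = 0"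
proof -
  let ?\<chi> = "char_poly M" and ?X = "char_poly_matrix M"
  let ?Y = "adj_mat ?X"
  \<comment> \<open>The adjugate is a polynomial in \<open>x\<close> with matrix coefficients;
    \<open>B k\<close> is its coefficient of \<open>x ^ k\<close>.\<close>
  define B where "B k = mat n n (\<lambda>(i, j). coeff (?Y $$ (i, j)) k)" for k
  have X: "?X \<in> carrier_mat n n" using M by simp
  note Y = adj_mat[OF X]
  have B: "B k \<in> carrier_mat n n" for k by (simp add: B_def)
  \<comment> \<open>Compares coefficients of \<open>x ^ k\<close>; for \<open>k = 0\<close> the
    product of \<open>x\<close> with the adjugate contributes nothing.\<close>
  have rel: "coeff ?\<chi> k * (if i = j then 1 else 0) + (M * B k) $$ (i, j)
      = (if k = 0 then 0 else B (k - 1) $$ (i, j))" if ij: "i < n" "j < n" for i j k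
  proof -
    have "(\<Sum>r<n. ?X $$ (i, r) * ?Y $$ (r, j)) = (if i = j then ?\<chi> else 0)"
      using arg_cong[OF Y(2), of "\<lambda>Z. Z $$ (i, j)"] ij mult_mat_entry[OF X Y(1), of i j]
      by (simp add: char_poly_def)
    moreover have "?X $$ (i, r) * ?Y $$ (r, j)
        = (if i = r then pCons 0 (?Y $$ (i, j)) else 0) - Polynomial.smult (M $$ (i, r)) (?Y $$ (r, j))" 
      if "r < n" for r
      using ij that M by (simp add: char_poly_matrix_def)
    ultimately have "(\<Sum>r<n. (if i = r then pCons 0 (?Y $$ (i, j)) else 0)
        - Polynomial.smult (M $$ (i, r)) (?Y $$ (r, j))) = (if i = j then ?\<chi> else 0)"
      by (metis (no_types, lifting) lessThan_iff sum.cong)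
    then have "pCons 0 (?Y $$ (i, j)) - (\<Sum>r<n. Polynomial.smult (M $$ (i, r)) (?Y $$ (r, j)))
        = (if i = j then ?\<chi> else 0)"
      using ij by (simp add: sum_subtractf sum.delta')
    from arg_cong[OF this, of "\<lambda>p. coeff p k"]
    have "(if k = 0 then 0 else coeff (?Y $$ (i, j)) (k - 1))
        - (\<Sum>r<n. M $$ (i, r) * coeff (?Y $$ (r, j)) k) = coeff ?\<chi> k * (if i = j then 1 else 0)"
      by (cases k) (auto simp: coeff_sum split: if_splits)
    moreover have "(M * B k) $$ (i, j) = (\<Sum>r<n. M $$ (i, r) * coeff (?Y $$ (r, j)) k)"
      using ij by (subst mult_mat_entry[OF M B]) (auto simp: B_def)
    ultimately show ?thesis using ij by (auto simp: B_def algebra_simps)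
  qed
  \<comment> \<open>Multiplying relation \<open>k\<close> by the power \<open>k\<close> of
    \<open>M\<close> and adding up to \<open>K\<close> cancels all adjugate coefficients except
    \<open>B K\<close>.\<close>
  have partial: "(\<Sum>k\<le>K. coeff ?\<chi> k * (M ^\<^sub>m k) $$ (i, j)) + (M ^\<^sub>m Suc K * B K) $$ (i, j) = 0" for K
  proof (induction K)
    case 0
    then show ?case using rel[OF i j, of 0] M i j by auto
  next
    case (Suc K)
    let ?P = "M ^\<^sub>m Suc K"
    have P: "?P \<in> carrier_mat n n" using M by (rule pow_carrier_mat)
    have MB: "M * B (Suc K) \<in> carrier_mat n n" using M B by (rule mult_carrier_mat)
    have "M ^\<^sub>m Suc (Suc K) * B (Suc K) = ?P * (M * B (Suc K))"
      using P M B by (subst pow_mat.simps, subst assoc_mult_mat[of _ n n _ n _ n]) auto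
    then have "(M ^\<^sub>m Suc (Suc K) * B (Suc K)) $$ (i, j)
        = (\<Sum>r<n. ?P $$ (i, r) * (M * B (Suc K)) $$ (r, j))"
      using mult_mat_entry[OF P MB i j] by simp
    also have "\<dots> = (\<Sum>r<n. ?P $$ (i, r) * (B K $$ (r, j) - coeff ?\<chi> (Suc K) * (if r = j then 1 else 0)))"
      using rel[OF _ j, of _ "Suc K"] by (intro sum.cong refl arg_cong2[of _ _ _ _ "(*)"]) (simp add: algebra_simps)
    also have "\<dots> = (\<Sum>r<n. ?P $$ (i, r) * B K $$ (r, j)) 
        - (\<Sum>r<n. if r = j then ?P $$ (i, j) * coeff ?\<chi> (Suc K) else 0)"
      unfolding sum_subtractf[symmetric] by (intro sum.cong) (auto simp: algebra_simps)
    also have "\<dots> = (?P * B K) $$ (i, j) - coeff ?\<chi> (Suc K) * ?P $$ (i, j)"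
      using j by (simp add: mult_mat_entry[OF P B i j] sum.delta del: pow_mat.simps)
    finally show ?case using Suc.IH by (simp del: pow_mat.simps)
  qed
  \<comment> \<open>Beyond the degrees of \<open>?\<chi>\<close> and of every adjugate entry, so
    that \<open>B K\<close> is zero and the sum up to \<open>K\<close> contains all of
    \<open>?\<chi>\<close>.\<close>
  define K where "K = degree ?\<chi> + (\<Sum>(i, j)\<in>{..<n} \<times> {..<n}. degree (?Y $$ (i, j))) + 1"
  have "coeff (?Y $$ (r, q)) K = 0" if "r < n" "q < n" for r q
  proof (rule coeff_eq_0)
    have "degree (?Y $$ (r, q)) \<le> (\<Sum>(i, j)\<in>{..<n} \<times> {..<n}. degree (?Y $$ (i, j)))"
      using that member_le_sum[of "(r, q)" "{..<n} \<times> {..<n}" "\<lambda>(i, j). degree (?Y $$ (i, j))"] by auto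
    then show "degree (?Y $$ (r, q)) < K" by (simp add: K_def)
  qed
  then have "B K = 0\<^sub>m n n" by (intro eq_matI) (auto simp: B_def)
  then have "(M ^\<^sub>m Suc K * B K) $$ (i, j) = 0"
    using right_mult_zero_mat[OF pow_carrier_mat[OF M, of "Suc K"], of n] i j
    by (simp del: pow_mat.simps)
  with partial[of K] have "(\<Sum>k\<le>K. coeff ?\<chi> k * (M ^\<^sub>m k) $$ (i, j)) = 0" by simp
  moreover have "(\<Sum>k\<le>degree ?\<chi>. coeff ?\<chi> k * (M ^\<^sub>m k) $$ (i, j))
      = (\<Sum>k\<le>K. coeff ?\<chi> k * (M ^\<^sub>m k) $$ (i, j))"
    by (rule sum.mono_neutral_left) (auto simp: K_def coeff_eq_0)
  ultimately show ?thesis by simp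
qed

text \<open>Cayley-Hamilton multiplied on the right by \<open>M ^\<^sub>m l\<close>, ready for
  products of the characteristic polynomial with a power series.\<close>

lemma char_poly_multiple_entry:
  fixes M :: "complex mat"
  assumes M: "M \<in> carrier_mat n n" and i: "i < n" and j: "j < n"
  shows "(\<Sum>k\<le>degree (char_poly M). coeff (char_poly M) k * (M ^\<^sub>m (k + l)) $$ (i, j)) = 0"
proof -
  let ?\<chi> = "char_poly M"
  have "(\<Sum>k\<le>degree ?\<chi>. coeff ?\<chi> k * (M ^\<^sub>m (k + l)) $$ (i, j))
      = (\<Sum>k\<le>degree ?\<chi>. \<Sum>r<n. coeff ?\<chi> k * (M ^\<^sub>m k) $$ (i, r) * (M ^\<^sub>m l) $$ (r, j))"
    by (simp add: pow_mat_add[OF M] mult_mat_entry[OF pow_carrier_mat[OF M] pow_carrier_mat[OF M] i j]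
        sum_distrib_left mult.assoc)
  also have "\<dots> = (\<Sum>r<n. (\<Sum>k\<le>degree ?\<chi>. coeff ?\<chi> k * (M ^\<^sub>m k) $$ (i, r)) * (M ^\<^sub>m l) $$ (r, j))"
    by (subst sum.swap) (simp add: sum_distrib_right)
  also have "\<dots> = 0"
    by (simp add: cayley_hamilton_entry[OF M i])
  finally show ?thesis .
qed

section \<open>Power series of matrices\<close>

lemma pow_mat_entry_bound:
  fixes M :: "complex mat"
  assumes M: "M \<in> carrier_mat n n"
  obtains R where "R \<ge> 0" "\<And>k i j. i < n \<Longrightarrow> j < n \<Longrightarrow> cmod ((M ^\<^sub>m k) $$ (i, j)) \<le> R ^ k"
proof -
  define c where "c = (\<Sum>(i, j)\<in>{..<n} \<times> {..<n}. cmod (M $$ (i, j)))"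
  have c: "cmod (M $$ (i, j)) \<le> c" if "i < n" "j < n" for i j
    unfolding c_def
    using that member_le_sum[of "(i, j)" "{..<n} \<times> {..<n}" "\<lambda>(i, j). cmod (M $$ (i, j))"] by auto
  \<comment> \<open>\<open>c\<close> bounds every entry of \<open>M\<close>, and an entry of a
    product has \<open>n\<close> terms, so each further power costs a factor of at most
    \<open>real n * c\<close>.\<close>
  define R where "R = max 1 (real n * c)"
  have "cmod ((M ^\<^sub>m k) $$ (i, j)) \<le> R ^ k" if "i < n" "j < n" for k i j
    using that
  proof (induction k arbitrary: i j)
    case 0
    then show ?case using M by simp
  next
    case (Suc k)
    have "cmod ((M ^\<^sub>m Suc k) $$ (i, j)) \<le> (\<Sum>r<n. R ^ k * c)"
      unfolding pow_mat.simps mult_mat_entry[OF pow_carrier_mat[OF M] M Suc.prems]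
      by (rule sum_norm_le)
        (auto simp: norm_mult R_def intro!: mult_mono Suc.IH[unfolded R_def] c Suc.prems)
    also have "\<dots> = R ^ k * (real n * c)" by simp
    also have "\<dots> \<le> R ^ Suc k" by (simp add: R_def mult.commute mult_right_mono)
    finally show ?case .
  qed
  then show thesis by (rule that[of R, rotated]) (auto simp: R_def)
qed

text \<open>Comparison with the scalar series at \<open>R\<close>, where powers of \<open>M\<close>
  have entries bounded by powers of \<open>R\<close>; the shift costs the constant
  \<open>R ^ l\<close>.\<close>

lemma summable_power_series_entry:
  fixes M :: "complex mat"
  assumes M: "M \<in> carrier_mat n n" and i: "i < n" and j: "j < n" and F: "fps_conv_radius F = \<infinity>"
  shows "summable (\<lambda>k. fps_nth F k * (M ^\<^sub>m (k + l)) $$ (i, j))"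
proof -
  obtain R where R: "R \<ge> 0" "\<And>k i j. i < n \<Longrightarrow> j < n \<Longrightarrow> cmod ((M ^\<^sub>m k) $$ (i, j)) \<le> R ^ k"
    using pow_mat_entry_bound[OF M] by blast
  have "summable (\<lambda>k. norm (fps_nth F k * of_real R ^ k))"
    by (rule norm_summable_fps) (simp add: F)
  then have "summable (\<lambda>k. R ^ l * norm (fps_nth F k * of_real R ^ k))"
    by (rule summable_mult)
  then show ?thesis
  proof (rule summable_comparison_test'[where N = 0])
    fix k
    have "norm (fps_nth F k * (M ^\<^sub>m (k + l)) $$ (i, j)) \<le> norm (fps_nth F k) * R ^ (k + l)"
      unfolding norm_mult by (intro mult_left_mono R i j norm_ge_zero)
    then show "norm (fps_nth F k * (M ^\<^sub>m (k + l)) $$ (i, j))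
        \<le> R ^ l * norm (fps_nth F k * of_real R ^ k)"
      using R(1) by (simp add: norm_mult norm_power power_add ac_simps)
  qed
qed

text \<open>The Cauchy product, indexed by the coefficients of \<open>p\<close> so that the range
  does not depend on \<open>k\<close> and the finite sum can be exchanged with an infinite
  one.\<close>

lemma fps_nth_poly_mult:
  fixes p :: "complex poly"
  shows "fps_nth (fps_of_poly p * H) k
           = (\<Sum>a\<le>degree p. coeff p a * (if a \<le> k then fps_nth H (k - a) else 0))"
proof -
  have "fps_nth (fps_of_poly p * H) k = (\<Sum>a\<in>{..k} \<inter> {..degree p}. coeff p a * fps_nth H (k - a))"
    unfolding fps_mult_nth atLeast0AtMost
    by (rule sum.mono_neutral_cong_right) (auto simp: coeff_eq_0)
  also have "\<dots> = (\<Sum>a\<le>degree p. coeff p a * (if a \<le> k then fps_nth H (k - a) else 0))"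
    by (rule sum.mono_neutral_cong_left) auto
  finally show ?thesis .
qed

text \<open>The double sum over \<open>a\<close> (characteristic polynomial) and \<open>l\<close>
  (series \<open>H\<close>), with \<open>k = a + l\<close>, is regrouped by \<open>l\<close>: each
  group is zero by Cayley-Hamilton. As \<open>a\<close> has a finite range, linearity of convergent
  series suffices.\<close>

lemma char_poly_times_series_sums_zero:
  fixes M :: "complex mat"
  assumes M: "M \<in> carrier_mat n n" and i: "i < n" and j: "j < n" and H: "fps_conv_radius H = \<infinity>"
  shows "(\<lambda>k. fps_nth (fps_of_poly (char_poly M) * H) k * (M ^\<^sub>m k) $$ (i, j)) sums 0"
proof -
  let ?\<chi> = "char_poly M"
  define S where "S a = (\<Sum>l. fps_nth H l * (M ^\<^sub>m (l + a)) $$ (i, j))" for a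
  have S: "(\<lambda>l. fps_nth H l * (M ^\<^sub>m (l + a)) $$ (i, j)) sums S a" for a
    unfolding S_def by (rule summable_sums[OF summable_power_series_entry[OF M i j H]])
  \<comment> \<open>The same series with \<open>a\<close> zeros put in front, so that its index is
    again the power of \<open>M\<close>.\<close>
  have "(\<lambda>k. (if a \<le> k then fps_nth H (k - a) else 0) * (M ^\<^sub>m k) $$ (i, j)) sums S a" for a
    using S[of a] by (subst sums_zero_iff_shift[symmetric, of a]) auto
  then have "(\<lambda>k. \<Sum>a\<le>degree ?\<chi>. coeff ?\<chi> a *
      ((if a \<le> k then fps_nth H (k - a) else 0) * (M ^\<^sub>m k) $$ (i, j))) sums (\<Sum>a\<le>degree ?\<chi>. coeff ?\<chi> a * S a)"
    by (intro sums_sum sums_mult)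
  moreover have "(\<lambda>l. \<Sum>a\<le>degree ?\<chi>. coeff ?\<chi> a * (fps_nth H l * (M ^\<^sub>m (l + a)) $$ (i, j)))
      sums (\<Sum>a\<le>degree ?\<chi>. coeff ?\<chi> a * S a)"
    by (intro sums_sum sums_mult S)
  moreover have "(\<Sum>a\<le>degree ?\<chi>. coeff ?\<chi> a * (fps_nth H l * (M ^\<^sub>m (l + a)) $$ (i, j))) = 0" for l
    using arg_cong[OF char_poly_multiple_entry[OF M i j, of l], of "\<lambda>x. fps_nth H l * x"]
    by (simp add: sum_distrib_left ac_simps)
  ultimately have "(\<lambda>k. \<Sum>a\<le>degree ?\<chi>. coeff ?\<chi> a *
      ((if a \<le> k then fps_nth H (k - a) else 0) * (M ^\<^sub>m k) $$ (i, j))) sums 0"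
    by (metis (no_types, lifting) sums_cong sums_unique2 sums_zero)
  then show ?thesis
    by (simp add: fps_nth_poly_mult sum_distrib_right mult.assoc)
qed

text \<open>A common form for polynomials, the exponential and entire functions of a matrix. Entries
  are meaningful when their series converge, as they do for infinite radius.\<close>

definition mat_series :: "complex fps \<Rightarrow> complex mat \<Rightarrow> complex mat" where
  "mat_series F M = mat (dim_row M) (dim_row M) (\<lambda>(i, j). \<Sum>k. fps_nth F k * (M ^\<^sub>m k) $$ (i, j))"

lemma mat_series_carrier: "M \<in> carrier_mat n n \<Longrightarrow> mat_series F M \<in> carrier_mat n n"
  by (intro carrier_matI) (auto simp: mat_series_def)

lemma mat_poly_eq_mat_series: "mat_poly p M = mat_series (fps_of_poly p) M"
  by (auto simp: mat_poly_def mat_series_def le_degree intro!: eq_matI suminf_finite[symmetric])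

lemma mat_exp_eq_mat_series: "mat_exp M = mat_series (fps_exp 1) M"
  by (simp add: mat_exp_def mat_series_def)

lemma mat_series_diff:
  assumes M: "M \<in> carrier_mat n n" and "fps_conv_radius F = \<infinity>" "fps_conv_radius G = \<infinity>"
  shows "mat_series (F - G) M = mat_series F M - mat_series G M"
proof (rule eq_matI)
  fix i j assume "i < dim_row (mat_series F M - mat_series G M)" "j < dim_col (mat_series F M - mat_series G M)"
  then have ij: "i < n" "j < n" using M by (auto simp: mat_series_def)
  show "mat_series (F - G) M $$ (i, j) = (mat_series F M - mat_series G M) $$ (i, j)"
    using ij M suminf_diff[OF summable_power_series_entry[OF M ij assms(2), of 0]
        summable_power_series_entry[OF M ij assms(3), of 0]]
    by (simp add: mat_series_def left_diff_distrib)
qed (simp_all add: mat_series_def)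

lemma has_fps_expansion_poly: "poly p has_fps_expansion fps_of_poly (p :: complex poly)"
  by (simp add: has_fps_expansion_def)

lemma mat_fun_entire:
  assumes M: "M \<in> carrier_mat n n" and f: "f holomorphic_on UNIV" "f has_fps_expansion F"
  shows "mat_fun f M = mat_series F M"
proof -
  let ?\<chi> = "char_poly M"
  obtain xs where xs: "?\<chi> = (\<Prod>a\<leftarrow>xs. [:- a, 1:])" using char_poly_factorized[OF M] by blast
  \<comment> \<open>The interpolant chosen in \<open>mat_fun\<close>; the existence proof is what
    gives this choice its property.\<close>
  define q where "q = (SOME p. hermite_interpolates p f M)"
  have "\<exists>p. hermite_interpolates p f M"
    unfolding hermite_interpolates_def xs by (rule hermite_interpolant_exists)
  then have q: "hermite_interpolates q f M" unfolding q_def by (rule someI_ex)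
  define g where "g z = f z - poly q z" for z
  have g: "g holomorphic_on UNIV" unfolding g_def by (intro holomorphic_intros f)
  have "(deriv ^^ j) g \<mu> = 0" if "j < Polynomial.order \<mu> (\<Prod>a\<leftarrow>xs. [:- a, 1:])" for \<mu> j
  proof -
    have "(deriv ^^ j) g \<mu> = (deriv ^^ j) f \<mu> - (deriv ^^ j) (poly q) \<mu>"
      unfolding g_def by (rule higher_deriv_diff[of _ UNIV]) (auto intro!: f holomorphic_intros)
    then show ?thesis using q that by (simp add: hermite_interpolates_def xs higher_deriv_poly)
  qed
  from entire_factor_out_roots[OF g this] obtain h
    where h: "h holomorphic_on UNIV" "g = (\<lambda>z. poly ?\<chi> z * h z)" unfolding xs by blast
  define H where "H = fps_expansion h 0"
  have H: "fps_conv_radius H = \<infinity>"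
    using conv_radius_fps_expansion[of h 0 \<infinity>] h(1) by (simp add: H_def)
  have "h has_fps_expansion H"
    unfolding H_def by (rule has_fps_expansion_fps_expansion[of UNIV]) (use h in auto)
  then have "g has_fps_expansion fps_of_poly ?\<chi> * H"
    unfolding h(2) by (intro has_fps_expansion_mult has_fps_expansion_poly)
  moreover have "g has_fps_expansion F - fps_of_poly q"
    unfolding g_def by (intro has_fps_expansion_diff has_fps_expansion_poly f)
  \<comment> \<open>Both expansions belong to \<open>g\<close>, and Taylor coefficients at 0 are
    unique, so the factorization passes to formal power series.\<close>
  ultimately have eq: "F = fps_of_poly q + fps_of_poly ?\<chi> * H"
    using fps_expansion_unique_complex by (metis diff_add_cancel add.commute)
  have "mat_series F M = mat_poly q M"
    unfolding mat_poly_eq_mat_series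
  proof (rule eq_matI)
    fix i j assume "i < dim_row (mat_series (fps_of_poly q) M)" "j < dim_col (mat_series (fps_of_poly q) M)"
    then have ij: "i < n" "j < n" using M by (auto simp: mat_series_def)
    have "summable (\<lambda>k. fps_nth (fps_of_poly q) k * (M ^\<^sub>m k) $$ (i, j))"
      using summable_power_series_entry[OF M ij, of "fps_of_poly q" 0] by simp
    from sums_add[OF summable_sums[OF this] char_poly_times_series_sums_zero[OF M ij H]]
    have "(\<lambda>k. fps_nth F k * (M ^\<^sub>m k) $$ (i, j))
        sums (\<Sum>k. fps_nth (fps_of_poly q) k * (M ^\<^sub>m k) $$ (i, j))"
      by (simp add: eq distrib_right)
    then show "mat_series F M $$ (i, j) = mat_series (fps_of_poly q) M $$ (i, j)"
      using ij M by (simp add: mat_series_def sums_iff)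
  qed (simp_all add: mat_series_def)
  then show ?thesis by (simp add: mat_fun_def q_def)
qed

text \<open>Exchanging the finite sum over \<open>j\<close> with the series shows that a matrix
  function acts on \<open>v\<close> through the Krylov vectors
  \<open>M ^\<^sub>m k *\<^sub>v v\<close> alone.\<close>

lemma mat_series_mult_vec:
  assumes M: "M \<in> carrier_mat n n" and v: "v \<in> carrier_vec n" and F: "fps_conv_radius F = \<infinity>" and i: "i < n"
  shows "(mat_series F M *\<^sub>v v) $ i = (\<Sum>k. fps_nth F k * (M ^\<^sub>m k *\<^sub>v v) $ i)"
proof -
  have s: "summable (\<lambda>k. fps_nth F k * (M ^\<^sub>m k) $$ (i, j) * v $ j)" if "j < n" for j
    using summable_mult2[OF summable_power_series_entry[OF M i that F, of 0]] by simp
  have "(mat_series F M *\<^sub>v v) $ i = (\<Sum>j<n. (\<Sum>k. fps_nth F k * (M ^\<^sub>m k) $$ (i, j)) * v $ j)"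
    using M v i by (auto simp: scalar_prod_def mat_series_def lessThan_atLeast0 intro!: sum.cong)
  also have "\<dots> = (\<Sum>j<n. \<Sum>k. fps_nth F k * (M ^\<^sub>m k) $$ (i, j) * v $ j)"
    by (intro sum.cong refl suminf_mult2)
      (use summable_power_series_entry[OF M i _ F, of _ 0] in simp)
  also have "\<dots> = (\<Sum>k. \<Sum>j<n. fps_nth F k * (M ^\<^sub>m k) $$ (i, j) * v $ j)"
    by (rule suminf_sum[symmetric]) (use s in auto)
  also have "\<dots> = (\<Sum>k. fps_nth F k * (M ^\<^sub>m k *\<^sub>v v) $ i)"
    using pow_carrier_mat[OF M] v i M
    by (intro suminf_cong) (auto simp: scalar_prod_def lessThan_atLeast0 sum_distrib_left mult.assoc intro!: sum.cong)
  finally show ?thesis .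
qed

section \<open>The spectral norm\<close>

lemma cmod_le_vec_norm2: "i < dim_vec v \<Longrightarrow> cmod (v $ i) \<le> vec_norm2 v"
  unfolding vec_norm2_def using member_le_L2_set[of "{..<dim_vec v}" i "\<lambda>i. cmod (v $ i)"] by simp

lemma vec_norm2_nonneg: "0 \<le> vec_norm2 v"
  by (simp add: vec_norm2_def)

lemma vec_norm2_smult: "vec_norm2 (c \<cdot>\<^sub>v v) = cmod c * vec_norm2 v"
  unfolding vec_norm2_def L2_set_right_distrib[OF norm_ge_zero]
  by (auto simp: norm_mult intro!: L2_set_cong)

text \<open>A crude bound by the sum of all entry moduli; it makes the supremum in
  \<open>mat_norm2\<close> bounded above.\<close>

lemma vec_norm2_mult_bounded:
  assumes M: "M \<in> carrier_mat nr nc"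
  obtains B where "\<And>v. v \<in> carrier_vec nc \<Longrightarrow> vec_norm2 (M *\<^sub>v v) \<le> B * vec_norm2 v"
proof
  fix v :: "complex vec" assume v: "v \<in> carrier_vec nc"
  have "vec_norm2 (M *\<^sub>v v) \<le> (\<Sum>i<nr. cmod ((M *\<^sub>v v) $ i))"
    using L2_set_le_sum[of "{..<nr}" "\<lambda>i. cmod ((M *\<^sub>v v) $ i)"] M by (simp add: vec_norm2_def)
  also have "\<dots> \<le> (\<Sum>i<nr. \<Sum>j<nc. cmod (M $$ (i, j)) * vec_norm2 v)"
  proof (rule sum_mono)
    fix i assume "i \<in> {..<nr}"
    then have "(M *\<^sub>v v) $ i = (\<Sum>j<nc. M $$ (i, j) * v $ j)"
      using M v by (auto simp: scalar_prod_def lessThan_atLeast0 intro!: sum.cong)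
    then show "cmod ((M *\<^sub>v v) $ i) \<le> (\<Sum>j<nc. cmod (M $$ (i, j)) * vec_norm2 v)"
      using v by (auto simp: norm_mult intro!: sum_norm_le mult_left_mono cmod_le_vec_norm2)
  qed
  also have "\<dots> = (\<Sum>i<nr. \<Sum>j<nc. cmod (M $$ (i, j))) * vec_norm2 v"
    by (simp add: sum_distrib_right)
  finally show "vec_norm2 (M *\<^sub>v v) \<le> (\<Sum>i<nr. \<Sum>j<nc. cmod (M $$ (i, j))) * vec_norm2 v" .
qed

lemma vec_norm2_mult_le:
  assumes M: "M \<in> carrier_mat nr nc" and v: "v \<in> carrier_vec nc"
  shows "vec_norm2 (M *\<^sub>v v) \<le> mat_norm2 M * vec_norm2 v"
proof -
  obtain B where B: "\<And>v. v \<in> carrier_vec nc \<Longrightarrow> vec_norm2 (M *\<^sub>v v) \<le> B * vec_norm2 v"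
    using vec_norm2_mult_bounded[OF M] by blast
  show ?thesis
  \<comment> \<open>A vector of norm zero cannot be normalized; for it the crude bound gives a left
    side of at most 0.\<close>
  proof (cases "vec_norm2 v = 0")
    case True
    then show ?thesis using B[OF v] by simp
  next
    case False
    define t where "t = vec_norm2 v"
    have t: "t > 0" using False vec_norm2_nonneg[of v] by (simp add: t_def)
    define u where "u = complex_of_real (1 / t) \<cdot>\<^sub>v v"
    have u: "u \<in> carrier_vec nc" "vec_norm2 u = 1"
      using v t by (auto simp: u_def vec_norm2_smult norm_divide simp flip: t_def)
    have "bdd_above ((\<lambda>v. vec_norm2 (M *\<^sub>v v)) ` {v \<in> carrier_vec nc. vec_norm2 v = 1})"
      by (rule bdd_aboveI2[of _ _ B]) (use B in force)
    then have "vec_norm2 (M *\<^sub>v u) \<le> mat_norm2 M"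
      unfolding mat_norm2_def using M u by (intro cSUP_upper) auto
    moreover have "vec_norm2 (M *\<^sub>v u) = 1 / t * vec_norm2 (M *\<^sub>v v)"
      unfolding u_def mult_mat_vec[OF M v] vec_norm2_smult using t by (simp add: norm_divide)
    ultimately show ?thesis using t by (simp add: field_simps flip: t_def)
  qed
qed

text \<open>A real supremum has no default sign, so a concrete vector is tested;
  \<open>n \<ge> 1\<close> provides the first unit vector.\<close>

lemma mat_norm2_nonneg:
  assumes M: "M \<in> carrier_mat n n" and n: "n \<ge> 1"
  shows "0 \<le> mat_norm2 M"
proof -
  let ?u = "unit_vec n 0 :: complex vec"
  have "vec_norm2 ?u \<ge> 1"
    using cmod_le_vec_norm2[of 0 ?u] n by simp
  moreover have "0 \<le> mat_norm2 M * vec_norm2 ?u"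
    using vec_norm2_nonneg[of "M *\<^sub>v ?u"] vec_norm2_mult_le[OF M, of ?u] by simp
  ultimately show ?thesis by (simp add: zero_le_mult_iff)
qed

text \<open>Testing the bound on the constant function 1 and the 1-by-1 identity makes the supremum
  1, so \<open>C\<close> lies above a matrix norm.\<close>

lemma crouzeix_palencia_bound_nonneg:
  assumes "crouzeix_palencia_bound C"
  shows "0 \<le> C"
proof -
  let ?M = "1\<^sub>m 1 :: complex mat" and ?z = "unit_vec 1 0 :: complex vec"
  have "?z $ 0 \<noteq> 0\<^sub>v 1 $ 0" by simp
  then have "?z \<noteq> 0\<^sub>v 1" by metis
  then have "((?M *\<^sub>v ?z) \<bullet>c ?z) / (?z \<bullet>c ?z) \<in> field_of_values ?M"
    unfolding field_of_values_def by (intro CollectI exI[of _ ?z] conjI refl) simp_all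
  then have "field_of_values ?M \<noteq> {}" by blast
  then have "(SUP \<zeta>\<in>field_of_values ?M. cmod 1) = 1" by simp
  moreover have "mat_norm2 (mat_fun (\<lambda>_. 1) ?M) \<le> C * (SUP \<zeta>\<in>field_of_values ?M. cmod 1)"
    using assms[unfolded crouzeix_palencia_bound_def, rule_format, of 1 ?M "\<lambda>_. 1"]
    by (simp only: one_carrier_mat analytic_on_const order_refl)
  moreover have "0 \<le> mat_norm2 (mat_fun (\<lambda>_. 1) ?M)"
    by (rule mat_norm2_nonneg[of _ 1]) (simp_all add: mat_fun_def mat_poly_def)
  ultimately show ?thesis by simp
qed

section \<open>The Krylov vectors of \<open>K\<close> and \<open>W\<close>\<close>

text \<open>The recursion of matrix powers adds factors on the right, whereas a Krylov induction
  applies the new factor on the left.\<close>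

lemma pow_mat_Suc_mult_vec:
  assumes M: "M \<in> carrier_mat n n" and v: "v \<in> carrier_vec n"
  shows "M ^\<^sub>m Suc k *\<^sub>v v = M *\<^sub>v (M ^\<^sub>m k *\<^sub>v v)"
proof -
  have "M ^\<^sub>m Suc k = M * M ^\<^sub>m k"
    using pow_mat_add[OF M, of 1 k] M by simp
  then show ?thesis
    using assoc_mult_mat_vec[OF M pow_carrier_mat[OF M] v] by simp
qed

text \<open>The first \<open>n\<close> entries of \<open>K\<^sup>k c\<close> and of \<open>W\<^sup>k b\<close>.\<close>

fun phi_krylov :: "nat \<Rightarrow> nat \<Rightarrow> complex mat \<Rightarrow> (nat \<Rightarrow> complex vec) \<Rightarrow> nat \<Rightarrow> complex vec" where
  "phi_krylov n s A b 0 = b 0"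
| "phi_krylov n s A b (Suc k)
     = A *\<^sub>v phi_krylov n s A b k + (if k < s then b (Suc k) else 0\<^sub>v n)"

lemma phi_krylov_carrier:
  assumes "A \<in> carrier_mat n n" "\<And>i. i \<le> s \<Longrightarrow> b i \<in> carrier_vec n"
  shows "phi_krylov n s A b k \<in> carrier_vec n"
  using assms by (induction k) auto

text \<open>The Jordan block moves the unit vector up one index per step, so after
  \<open>k < s\<close> steps its 1 sits at index \<open>s - 1 - k\<close>, where the reversed
  columns of \<open>kiops_B\<close> hold \<open>b (Suc k)\<close>. From step \<open>s\<close> on the
  lower part is zero.\<close>

lemma kiops_krylov:
  assumes A: "A \<in> carrier_mat n n" and b: "\<And>i. i \<le> s \<Longrightarrow> b i \<in> carrier_vec n"
  shows "kiops_K n s A b ^\<^sub>m k *\<^sub>v kiops_c s b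
    = phi_krylov n s A b k @\<^sub>v vec s (\<lambda>i. if i + k + 1 = s then 1 else 0)"
proof (induction k)
  case 0
  have "kiops_K n s A b \<in> carrier_mat (n + s) (n + s)" "kiops_c s b \<in> carrier_vec (n + s)"
    using A b[of 0] by (auto simp: kiops_K_def kiops_c_def)
  moreover have "unit_vec s (s - 1) = vec s (\<lambda>i. if i + 0 + 1 = s then 1 else (0 :: complex))"
    by (intro eq_vecI) auto
  ultimately show ?case by (simp add: kiops_c_def)
next
  case (Suc k)
  let ?y = "vec s (\<lambda>i. if i + k + 1 = s then 1 else 0) :: complex vec"
  let ?x = "phi_krylov n s A b k"
  note x = phi_krylov_carrier[where s = s and b = b and k = k, OF A b]
  have K: "kiops_K n s A b \<in> carrier_mat (n + s) (n + s)" and c: "kiops_c s b \<in> carrier_vec (n + s)"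
    using A b[of 0] by (auto simp: kiops_K_def kiops_c_def)
  have B: "kiops_B n s b \<in> carrier_mat n s"
    using mat_of_cols_carrier(1)[of n "map b (rev [1..<Suc s])"] by (simp add: kiops_B_def del: upt_Suc)
  have "kiops_B n s b *\<^sub>v ?y = (if k < s then b (Suc k) else 0\<^sub>v n)"
  proof (rule eq_vecI)
    show "dim_vec (kiops_B n s b *\<^sub>v ?y) = dim_vec (if k < s then b (Suc k) else 0\<^sub>v n)"
      using B b[of "Suc k"] by auto
    fix i assume "i < dim_vec (if k < s then b (Suc k) else 0\<^sub>v n)"
    then have i: "i < n" using b[of "Suc k"] by (auto split: if_splits)
    have "(kiops_B n s b *\<^sub>v ?y) $ i = (\<Sum>j<s. kiops_B n s b $$ (i, j) * ?y $ j)"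
      using B i by (auto simp: scalar_prod_def lessThan_atLeast0 intro!: sum.cong)
    \<comment> \<open>Column \<open>j\<close> is \<open>b (s - j)\<close>. For
      \<open>k \<ge> s\<close> the truncated \<open>s - Suc k\<close> is 0, and the inner guard
      makes the term vanish.\<close>
    also have "\<dots> = (\<Sum>j<s. if j = s - Suc k then (if k < s then b (s - j) $ i else 0) else 0)"
      using i by (intro sum.cong) (auto simp: kiops_B_def mat_of_cols_index rev_nth simp del: upt_Suc)
    also have "\<dots> = (if k < s then b (Suc k) else 0\<^sub>v n) $ i"
      using i by (auto simp: sum.delta)
    finally show "(kiops_B n s b *\<^sub>v ?y) $ i = (if k < s then b (Suc k) else 0\<^sub>v n) $ i" .
  qed
  moreover have "jordan_block s 0 *\<^sub>v ?y = vec s (\<lambda>i. if i + Suc k + 1 = s then 1 else 0)"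
  proof (rule eq_vecI)
    fix i assume "i < dim_vec (vec s (\<lambda>i. if i + Suc k + 1 = s then 1 else 0 :: complex))"
    then have i: "i < s" by simp
    have "(jordan_block s 0 *\<^sub>v ?y) $ i = (\<Sum>j<s. jordan_block s 0 $$ (i, j) * ?y $ j)"
      using i by (auto simp: scalar_prod_def lessThan_atLeast0 intro!: sum.cong)
    \<comment> \<open>Only the superdiagonal survives. In the last row that column is missing, and
      the condition on \<open>k\<close> fails as well.\<close>
    also have "\<dots> = (\<Sum>j<s. if j = Suc i then (if i + Suc k + 1 = s then 1 else 0) else 0)"
      using i by (intro sum.cong) auto
    finally show "(jordan_block s 0 *\<^sub>v ?y) $ i = vec s (\<lambda>i. if i + Suc k + 1 = s then 1 else 0) $ i"
      using i by (auto simp: sum.delta)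
  qed simp
  moreover have "0\<^sub>m s n *\<^sub>v ?x = 0\<^sub>v s" using x by (intro eq_vecI) auto
  ultimately show ?case
    unfolding pow_mat_Suc_mult_vec[OF K c] Suc.IH
    by (simp add: kiops_K_def four_block_mat_mult_vec[OF A B _ _ x, of "0\<^sub>m s n" s])
qed

text \<open>Locates the ones in the Kronecker product of the Jordan block with the identity: the
  next block at the same inner position is \<open>n\<close> columns further on.\<close>

lemma div_mod_shift_iff:
  fixes n :: nat
  assumes "n \<ge> 1"
  shows "(Suc (i div n) = j div n \<and> i mod n = j mod n) \<longleftrightarrow> j = i + n"
proof
  assume "Suc (i div n) = j div n \<and> i mod n = j mod n"
  then show "j = i + n"
    by (metis add.commute add.left_commute div_mult_mod_eq mult_Suc)
qed (use assms in auto)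

text \<open>The Kronecker part moves the stacked vector up by one block of length \<open>n\<close>
  per step, and \<open>eye_zero\<close> reads its first block: the same \<open>b (Suc k)\<close>
  that \<open>kiops_B\<close> supplies, so the top parts obey one recursion.\<close>

lemma block_W_krylov:
  assumes A: "A \<in> carrier_mat n n" and b: "\<And>i. i \<le> s \<Longrightarrow> b i \<in> carrier_vec n"
    and n: "n \<ge> 1" and s: "s \<ge> 1"
  shows "block_W n s A ^\<^sub>m k *\<^sub>v stacked_b n s b = phi_krylov n s A b k
    @\<^sub>v vec (n * s) (\<lambda>i. if i + k * n < n * s then b (Suc ((i + k * n) div n)) $ ((i + k * n) mod n) else 0)"
proof (induction k)
  case 0
  have "block_W n s A \<in> carrier_mat (n + n * s) (n + n * s)" "stacked_b n s b \<in> carrier_vec (n + n * s)"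
    using A by (auto simp: block_W_def stacked_b_def kron_def)
  moreover have "stacked_b n s b = b 0 @\<^sub>v vec (n * s) (\<lambda>i. b (Suc (i div n)) $ (i mod n))"
  proof (rule eq_vecI)
    fix i assume "i < dim_vec (b 0 @\<^sub>v vec (n * s) (\<lambda>i. b (Suc (i div n)) $ (i mod n)))"
    then have i: "i < n + n * s" using b[of 0] by simp
    show "stacked_b n s b $ i = (b 0 @\<^sub>v vec (n * s) (\<lambda>i. b (Suc (i div n)) $ (i mod n))) $ i"
    proof (cases "i < n")
      case True
      then show ?thesis using i b[of 0] by (simp add: stacked_b_def algebra_simps)
    next
      case False
      then obtain r where "i = n + r" using le_Suc_ex not_less by blast
      then show ?thesis using i n b[of 0] by (simp add: stacked_b_def algebra_simps)
    qed
  qed (use b[of 0] in \<open>simp add: stacked_b_def\<close>)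
  ultimately show ?case by (auto intro!: arg_cong2[of _ _ _ _ append_vec])
next
  case (Suc k)
  define y where "y k = vec (n * s) (\<lambda>i. if i + k * n < n * s
    then b (Suc ((i + k * n) div n)) $ ((i + k * n) mod n) else 0)" for k
  let ?x = "phi_krylov n s A b k"
  let ?J = "kron (jordan_block s 0) (1\<^sub>m n)"
  note x = phi_krylov_carrier[where s = s and b = b and k = k, OF A b]
  have y: "y k \<in> carrier_vec (n * s)" for k by (simp add: y_def)
  have W: "block_W n s A \<in> carrier_mat (n + n * s) (n + n * s)"
    and c: "stacked_b n s b \<in> carrier_vec (n + n * s)"
    using A by (auto simp: block_W_def stacked_b_def kron_def)
  have E: "eye_zero n (n * s) \<in> carrier_mat n (n * s)" by (simp add: eye_zero_def)
  have J: "?J \<in> carrier_mat (n * s) (n * s)" by (auto simp: kron_def)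
  have "eye_zero n (n * s) *\<^sub>v y k = (if k < s then b (Suc k) else 0\<^sub>v n)"
  proof (rule eq_vecI)
    show "dim_vec (eye_zero n (n * s) *\<^sub>v y k) = dim_vec (if k < s then b (Suc k) else 0\<^sub>v n)"
      using b[of "Suc k"] by (auto simp: eye_zero_def)
    fix i assume "i < dim_vec (if k < s then b (Suc k) else 0\<^sub>v n)"
    then have i: "i < n" using b[of "Suc k"] by (auto split: if_splits)
    have "n * 1 \<le> n * s" using s by (intro mult_le_mono) simp_all
    then have i': "i < n * s" using i by linarith
    have "(eye_zero n (n * s) *\<^sub>v y k) $ i = (\<Sum>j<n * s. eye_zero n (n * s) $$ (i, j) * y k $ j)"
      using i E y[of k] by (auto simp: scalar_prod_def lessThan_atLeast0 intro!: sum.cong)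
    also have "\<dots> = (\<Sum>j<n * s. if j = i then y k $ j else 0)"
      using i by (intro sum.cong) (simp_all add: eye_zero_def)
    also have "\<dots> = y k $ i" using i' by (simp add: sum.delta)
    also have "\<dots> = (if k < s then b (Suc k) else 0\<^sub>v n) $ i"
    \<comment> \<open>After \<open>k\<close> shifts the first block is \<open>b (Suc k)\<close>
      while \<open>k < s\<close>; later the index leaves the range and the entry is the default
      0.\<close>
    proof (cases "k < s")
      case True
      then have "Suc k * n \<le> n * s" by (metis Suc_leI mult.commute mult_le_mono1)
      then show ?thesis using True i i' by (simp add: y_def)
    next
      case False
      then have "n * s \<le> k * n" by (simp add: mult.commute)
      then have "\<not> i + k * n < n * s" by linarith
      then show ?thesis using False i i' by (simp add: y_def)
    qed
    finally show "(eye_zero n (n * s) *\<^sub>v y k) $ i = (if k < s then b (Suc k) else 0\<^sub>v n) $ i" .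
  qed
  moreover have "?J *\<^sub>v y k = y (Suc k)"
  proof (rule eq_vecI)
    fix i assume "i < dim_vec (y (Suc k))"
    then have i: "i < n * s" by (simp add: y_def)
    have dm: "i div n < s" "i mod n < n" if "i < n * s" for i
      using that n by (auto simp: less_mult_imp_div_less mult.commute)
    have "(?J *\<^sub>v y k) $ i = (\<Sum>j<n * s. ?J $$ (i, j) * y k $ j)"
      using i J y[of k] by (auto simp: scalar_prod_def lessThan_atLeast0 intro!: sum.cong)
    also have "\<dots> = (\<Sum>j<n * s. if j = i + n then y k $ j else 0)"
    proof (rule sum.cong[OF refl])
      fix j assume "j \<in> {..<n * s}"
      then have j: "j < n * s" by simp
      have "?J $$ (i, j) = (if Suc (i div n) = j div n \<and> i mod n = j mod n then 1 else 0)"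
        using i j dm[OF i] dm[OF j] by (auto simp: kron_def mult.commute[of s n])
      then show "?J $$ (i, j) * y k $ j = (if j = i + n then y k $ j else 0)"
        by (simp add: div_mod_shift_iff[OF n])
    qed
    \<comment> \<open>If \<open>i + n\<close> is out of range, no column contributes, and
      \<open>y (Suc k)\<close> has its default 0 there.\<close>
    also have "\<dots> = y (Suc k) $ i"
      using i by (auto simp: sum.delta y_def algebra_simps)
    finally show "(?J *\<^sub>v y k) $ i = y (Suc k) $ i" .
  qed (simp add: y_def kron_def mult.commute)
  moreover have "0\<^sub>m (n * s) n *\<^sub>v ?x = 0\<^sub>v (n * s)" using x by (intro eq_vecI) auto
  ultimately have "block_W n s A *\<^sub>v (?x @\<^sub>v y k) = phi_krylov n s A b (Suc k) @\<^sub>v y (Suc k)"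
    using y[of "Suc k"]
    by (simp add: block_W_def four_block_mat_mult_vec[OF A E _ J x y, of "0\<^sub>m (n * s) n"])
  then show ?case
    unfolding pow_mat_Suc_mult_vec[OF W c] Suc.IH by (simp only: y_def)
qed

section \<open>The error bound\<close>

text \<open>The projection keeps the shared first \<open>n\<close> entries; the other entries of
  \<open>w\<close> only add nonnegative squares.\<close>

lemma vec_norm2_eye_zero_le:
  fixes v w :: "complex vec"
  assumes "v \<in> carrier_vec N" "w \<in> carrier_vec N'" "n \<le> N" "n \<le> N'"
    and eq: "\<And>i. i < n \<Longrightarrow> v $ i = w $ i"
  shows "vec_norm2 (eye_zero n N *\<^sub>v v) \<le> vec_norm2 w"
proof -
  have "(eye_zero n N *\<^sub>v v) $ i = w $ i" if i: "i < n" for i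
  proof -
    have "(eye_zero n N *\<^sub>v v) $ i = (\<Sum>j<N. eye_zero n N $$ (i, j) * v $ j)"
      using i assms(1) by (auto simp: eye_zero_def scalar_prod_def lessThan_atLeast0 intro!: sum.cong)
    also have "\<dots> = (\<Sum>j<N. if j = i then v $ j else 0)"
      using i by (intro sum.cong) (simp_all add: eye_zero_def)
    also have "\<dots> = w $ i" using i assms(3) eq[OF i] by (simp add: sum.delta)
    finally show ?thesis .
  qed
  moreover have "dim_vec (eye_zero n N *\<^sub>v v) = n" by (simp add: eye_zero_def)
  ultimately have "vec_norm2 (eye_zero n N *\<^sub>v v) = L2_set (\<lambda>i. cmod (w $ i)) {..<n}"
    unfolding vec_norm2_def by (intro L2_set_cong) simp_all
  also have "\<dots> \<le> vec_norm2 w"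
    unfolding vec_norm2_def L2_set_def using assms(2,4)
    by (intro real_sqrt_le_mono sum_mono2) auto
  finally show ?thesis .
qed

lemma kiops_error_le:
  fixes b :: "nat \<Rightarrow> complex vec"
  assumes C: "crouzeix_palencia_bound C" and n: "n \<ge> 1" and s: "s \<ge> 1"
    and A: "A \<in> carrier_mat n n" and b: "\<And>i. i \<le> s \<Longrightarrow> b i \<in> carrier_vec n"
  shows "vec_norm2 (eye_zero n (n + s) *\<^sub>v
           ((mat_exp (kiops_K n s A b) - mat_poly p (kiops_K n s A b)) *\<^sub>v kiops_c s b))
         \<le> C * vec_norm2 (stacked_b n s b)
             * (SUP \<zeta>\<in>field_of_values (block_W n s A). cmod (exp \<zeta> - poly p \<zeta>))"
    (is "vec_norm2 (?\<Pi> *\<^sub>v (?D *\<^sub>v ?c)) \<le> C * vec_norm2 ?b * ?S")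
proof -
  let ?K = "kiops_K n s A b" and ?W = "block_W n s A" and ?N = "n + n * s"
  let ?f = "\<lambda>z. exp z - poly p z"
  have f: "?f holomorphic_on UNIV" by (intro holomorphic_intros)
  define F where "F = fps_exp 1 - fps_of_poly p"
  have F: "fps_conv_radius F = \<infinity>"
    using fps_conv_radius_diff[of "fps_exp (1 :: complex)" "fps_of_poly p"] by (simp add: F_def)
  have K: "?K \<in> carrier_mat (n + s) (n + s)" and c: "?c \<in> carrier_vec (n + s)"
    using A b[of 0] by (auto simp: kiops_K_def kiops_c_def)
  have W: "?W \<in> carrier_mat ?N ?N" and bc: "?b \<in> carrier_vec ?N"
    using A by (auto simp: block_W_def stacked_b_def kron_def)
  have "?D = mat_series F ?K"
    unfolding F_def mat_poly_eq_mat_series mat_exp_eq_mat_series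
    by (rule mat_series_diff[OF K, symmetric]) simp_all
  \<comment> \<open>Both sides are series in Krylov vectors, whose first \<open>n\<close> entries
    are the same \<open>phi_krylov\<close>.\<close>
  moreover have "(mat_series F ?K *\<^sub>v ?c) $ i = (mat_series F ?W *\<^sub>v ?b) $ i" if "i < n" for i
  proof -
    have "(?K ^\<^sub>m k *\<^sub>v ?c) $ i = (?W ^\<^sub>m k *\<^sub>v ?b) $ i" for k
      using that phi_krylov_carrier[where s = s and b = b and k = k, OF A b]
      by (simp add: kiops_krylov[where s = s and b = b, OF A b] block_W_krylov[where s = s and b = b, OF A b n s])
    then show ?thesis using that
      by (simp add: mat_series_mult_vec[OF K c F] mat_series_mult_vec[OF W bc F])
  qed
  ultimately have "vec_norm2 (?\<Pi> *\<^sub>v (?D *\<^sub>v ?c)) \<le> vec_norm2 (mat_series F ?W *\<^sub>v ?b)"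
    using mult_mat_vec_carrier[OF mat_series_carrier[OF K] c]
      mult_mat_vec_carrier[OF mat_series_carrier[OF W] bc]
    by (intro vec_norm2_eye_zero_le[where N' = ?N]) simp_all
  also have "\<dots> \<le> mat_norm2 (mat_series F ?W) * vec_norm2 ?b"
    by (rule vec_norm2_mult_le[OF mat_series_carrier[OF W] bc])
  \<comment> \<open>The Crouzeix-Palencia hypothesis speaks of \<open>mat_fun\<close>, so the power
    series is identified with it.\<close>
  also have "mat_series F ?W = mat_fun ?f ?W"
  proof (rule mat_fun_entire[OF W f, symmetric])
    show "?f has_fps_expansion F"
      unfolding F_def using has_fps_expansion_exp[of 1]
      by (intro has_fps_expansion_diff has_fps_expansion_poly) simp
  qed
  also have "mat_norm2 (mat_fun ?f ?W) * vec_norm2 ?b \<le> (C * ?S) * vec_norm2 ?b"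
  proof (rule mult_right_mono[OF _ vec_norm2_nonneg])
    have "?f analytic_on field_of_values ?W"
      using f analytic_on_holomorphic by blast
    then show "mat_norm2 (mat_fun ?f ?W) \<le> C * ?S"
      using C[unfolded crouzeix_palencia_bound_def, rule_format, of ?N ?W ?f] W n by simp
  qed
  finally show ?thesis by (simp add: ac_simps)
qed

theorem corollary5p4:
  fixes C_cr :: real and n s m :: nat
    and A :: "complex mat" and b :: "nat \<Rightarrow> complex vec"
  assumes "C_cr \<le> 1 + sqrt 2" and "crouzeix_palencia_bound C_cr"
    and "n \<ge> 1" and "s \<ge> 1"
    and "A \<in> carrier_mat n n"
    and "\<And>i. i \<le> s \<Longrightarrow> b i \<in> carrier_vec n"
    and "b s \<noteq> 0\<^sub>v n"
    and "m \<ge> 1"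
  shows "(INF p\<in>poly_space (m - 1).
            vec_norm2 (eye_zero n (n + s) *\<^sub>v
              ((mat_exp (kiops_K n s A b) - mat_poly p (kiops_K n s A b)) *\<^sub>v kiops_c s b)))
         \<le> C_cr * vec_norm2 (stacked_b n s b) * best_approx (m - 1) exp (field_of_values (block_W n s A))"
    (is "(INF p\<in>_. ?L p) \<le> ?C * _")
proof -
  let ?S = "\<lambda>p. SUP \<zeta>\<in>field_of_values (block_W n s A). cmod (exp \<zeta> - poly p \<zeta>)"
  have C: "?C \<ge> 0"
    using crouzeix_palencia_bound_nonneg[OF assms(2)] vec_norm2_nonneg by (intro mult_nonneg_nonneg)
  have "bdd_below (?L ` poly_space (m - 1))"
    by (rule bdd_belowI2[of _ 0]) (rule vec_norm2_nonneg)
  then have inf: "(INF p\<in>poly_space (m - 1). ?L p) \<le> ?C * ?S p" if "p \<in> poly_space (m - 1)" for p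
    by (rule cINF_lower2[OF _ that kiops_error_le[OF assms(2-6)]])
  have ne: "0 \<in> poly_space (m - 1)" by (simp add: poly_space_def)
  show ?thesis
  \<comment> \<open>The factor is moved past the infimum in \<open>best_approx\<close> by division,
    which needs \<open>?C > 0\<close>. For \<open>?C = 0\<close> the bound at the zero polynomial is
    already the claim.\<close>
  proof (cases "?C = 0")
    case True
    then show ?thesis using inf[OF ne] by (simp only: mult_zero_left)
  next
    case False
    with C have C: "?C > 0" by linarith
    have "(INF p\<in>poly_space (m - 1). ?L p) / ?C \<le> best_approx (m - 1) exp (field_of_values (block_W n s A))"
      unfolding best_approx_def
    proof (rule cINF_greatest)
      show "poly_space (m - 1) \<noteq> {}" using ne by blast
      show "(INF p\<in>poly_space (m - 1). ?L p) / ?C \<le> ?S p" if "p \<in> poly_space (m - 1)" for p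
        using inf[OF that] C by (simp only: pos_divide_le_eq mult.commute)
    qed
    then show ?thesis using C by (simp only: pos_divide_le_eq mult.commute)
  qed
qed

end
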